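(* Let $\theta:=k^\star/W$, fix $\delta\in(0,1/2)$, and define $$\rho_{\mathrm P}:=\theta+\sqrt{\frac{1}{2W}\log\frac1\delta},\qquad \rho_{\mathrm N}:=\theta-\sqrt{\frac{1}{2W}\log\frac1\delta}.$$ Assume $0\le\rho_{\mathrm N}<\theta<\rho_{\mathrm P}\le 1$, that $p_i\ge\rho_{\mathrm P}$ for every $i\in\mathcal X$, and that $p_j\le\rho_{\mathrm N}$ for every $j\in\mathcal Y$. Define $$\pi_{\mathrm P}:=1-e^{-2W(\rho_{\mathrm P}-\theta)^2},\qquad \pi_{\mathrm N}:=e^{-2W(\theta-\rho_{\mathrm N})^2}.$$ Let $\lambda\in(\pi_{\mathrm N},\pi_{\mathrm P})$, and set $$\Delta_{\mathrm P}:=\pi_{\mathrm P}-\lambda>0,\qquad \Delta_{\mathrm N}:=\lambda-\pi_{\mathrm N}>0,\qquad \Delta:=\min\{\Delta_{\mathrm P},\Delta_{\mathrm N}\}.$$ Then the following hold for every integer $R\ge1$: 1. $\displaystyle \mathbb E[D(R)]\le |\mathcal X|e^{-2R\Delta_{\mathrm P}^2}+|\mathcal Y|e^{-2R\Delta_{\mathrm N}^2}\le|\mathcal N|e^{-2R\Delta^2}.$ 2. $\displaystyle \Pr\bigl(D(R)=0\bigr)\ge 1-|\mathcal N|e^{-2R\Delta^2}.$ 3. For any $\rho\in(0,1)$, if $$R\ge R_0:=\frac{1}{2\Delta^2}\log\!\left(\frac{|\mathcal N|}{\rho}\right),$$ then $\Pr\bigl(D(R)=0\bigr)\ge 1-\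rho$.
   Context: There is a finite set of agents $\mathcal N=\{1,\dots,N\}$, partitioned into a fixed set $\mathcal X\subset\mathcal N$ of persistent agents and the complementary set $\mathcal Y=\mathcal N\setminus\mathcal X$ of non-persistent agents. Time is discrete, $t=0,1,2,\dots$. For each agent $i$, the activity indicators $\{s_i(t)\}_{t\ge0}$, with values in $\{0,1\}$, are i.i.d. Bernoulli with parameter $p_i\in(0,1]$; the $p_i$ may differ between agents. Fix a window length $W\in\mathbb N$, $W\ge1$, and an integer count threshold $k^\star\in\{1,\dots,W\}$. For each window index $r=1,2,\dots$ the activity count of agent $i$ is $$K_{i,r}:=\sum_{u=0}^{W-1}s_i\bigl((r-1)W+u\bigr),$$ and its window vote is $b_{i,r}:=\mathbf 1\{K_{i,r}\ge k^\star\}$. After $R$ windows the cumulative vote score is $C_i(R):=\frac1R\sum_{r=1}^R b_{i,r}$. Given a macro-threshold $\lambda\in(0,1)$, the estimated persistence label is $\widehat\chi_i(R):=\mathbf 1\{C_i(R)\ge\lambda\}$ and the recovered persistent set is $\widehat{\mathcal X}(R):=\{i\in\mathcal N: C_i(R)\ge\lambda\}$. The true label is $\chi_i:=1$ if $i\in\mathcal X$ and $\chi_i:=0$ if $i\in\mathcal Y$. The Hamming identification error is $$D(R):=\sum_{i\in\mathcal N}\bigl|\widehat\chi_i(R)-\chi_i\bigr|,$$ so $D(R)=0$ if and only if $\widehat{\mathcal X}(R)=\mathcal X$. Here $\log$ is the natural logarithm. *)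

theory Defs
  imports "HOL-Probability.Probability"
begin

text \<open>
  The activity indicators are given as \<open>s i t \<omega>\<close>, read "agent \<open>i\<close> is active at time \<open>t\<close> on the
  outcome \<open>\<omega>\<close>". They are Boolean-valued because \<^const>\<open>bernoulli_pmf\<close> is a distribution on \<^typ>\<open>bool\<close>;
  \<^const>\<open>of_bool\<close> turns them into numbers in \<open>{0, 1}\<close>.

  Only each single agent's process is required to be i.i.d. in time. Nothing is required of the
  joint law of different agents.
\<close>

definition iid_bernoulli_activity ::
    "'w measure \<Rightarrow> (nat \<Rightarrow> 'w \<Rightarrow> bool) \<Rightarrow> real \<Rightarrow> bool" where
  "iid_bernoulli_activity M a q \<longleftrightarrow>
     prob_space.indep_vars M (\<lambda>_. count_space UNIV) a UNIV \<and>
     (\<forall>t. distr M (count_space UNIV) (a t) = measure_pmf (bernoulli_pmf q))"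

text \<open>Windows are numbered from \<open>r = 1\<close>, so the truncated subtraction \<open>r - 1\<close> is exact where used.\<close>

definition activity_count ::
    "nat \<Rightarrow> (nat \<Rightarrow> nat \<Rightarrow> 'w \<Rightarrow> bool) \<Rightarrow> nat \<Rightarrow> nat \<Rightarrow> 'w \<Rightarrow> nat" where
  "activity_count W s i r \<omega> = (\<Sum>u<W. of_bool (s i ((r - 1) * W + u) \<omega>))"

definition window_vote ::
    "nat \<Rightarrow> nat \<Rightarrow> (nat \<Rightarrow> nat \<Rightarrow> 'w \<Rightarrow> bool) \<Rightarrow> nat \<Rightarrow> nat \<Rightarrow> 'w \<Rightarrow> real" where
  "window_vote W k s i r \<omega> = of_bool (activity_count W s i r \<omega> \<ge> k)"

definition vote_score ::
    "nat \<Rightarrow> nat \<Rightarrow> (nat \<Rightarrow> nat \<Rightarrow> 'w \<Rightarrow> bool) \<Rightarrow> nat \<Rightarrow> nat \<Rightarrow> 'w \<Rightarrow> real" where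
  "vote_score W k s R i \<omega> = (1 / real R) * (\<Sum>r=1..R. window_vote W k s i r \<omega>)"

definition estimated_label ::
    "nat \<Rightarrow> nat \<Rightarrow> real \<Rightarrow> (nat \<Rightarrow> nat \<Rightarrow> 'w \<Rightarrow> bool) \<Rightarrow> nat \<Rightarrow> nat \<Rightarrow> 'w \<Rightarrow> real" where
  "estimated_label W k lam s R i \<omega> = of_bool (vote_score W k s R i \<omega> \<ge> lam)"

definition true_label :: "nat set \<Rightarrow> nat \<Rightarrow> real" where
  "true_label X i = of_bool (i \<in> X)"

definition hamming_error ::
    "nat set \<Rightarrow> nat set \<Rightarrow> nat \<Rightarrow> nat \<Rightarrow> real \<Rightarrow> (nat \<Rightarrow> nat \<Rightarrow> 'w \<Rightarrow> bool) \<Rightarrow> nat \<Rightarrow> 'w \<Rightarrow> real" where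
  "hamming_error A X W k lam s R \<omega> =
     (\<Sum>i\<in>A. \<bar>estimated_label W k lam s R i \<omega> - true_label X i\<bar>)"

end

theory Submission
  imports Defs
begin

text \<open>
  The detector applies two thresholds one after the other, and Hoeffding's inequality controls each
  of them. Within one window, the count of a single agent is a sum of \<open>W\<close> independent activity
  indicators of mean \<open>p\<close>, compared with \<open>k = W \<theta>\<close>. If \<open>p\<close> lies at or beyond \<open>\<rho>P\<close> above, or \<open>\<rho>N\<close>
  below, then the window vote has mean at least \<open>\<pi>P\<close>, or at most \<open>\<pi>N\<close>
  (\<open>expectation_window_vote_ge\<close>, \<open>expectation_window_vote_le\<close>).

  Distinct windows use disjoint sets of times, so the votes of one agent are again independent with
  values in \<open>[0, 1]\<close> (\<open>indep_vars_window_vote\<close>). Hoeffding's inequality now applies to the \<open>R\<close> votes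
  with the gap \<open>\<pi>P - lam\<close> or \<open>lam - \<pi>N\<close>, and bounds the probability that this agent is
  misclassified (\<open>prob_vote_score_less\<close>, \<open>prob_vote_score_ge\<close>).

  The Hamming error is the number of misclassified agents. Its mean is the sum of the
  misclassification probabilities. As it takes integer values, Markov's inequality at level \<open>1\<close> gives
  the probability of exact recovery, and the sufficient number of windows follows by solving for \<open>R\<close>.
\<close>

context prob_space
begin

section \<open>Hoeffding's inequality for variables in the unit interval\<close>

text \<open>
  The means of the window votes are known only up to a bound, hence the common lower bound \<open>q\<close>.
  Replacing the mean of the sum by \<open>card I * q\<close> shrinks the deviation, which only weakens the
  exponential bound.
\<close>

lemma Hoeffding_lower_tail_unit_interval:
  fixes Z :: "'b \<Rightarrow> 'a \<Rightarrow> real"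
  assumes "finite I" and indep: "indep_vars (\<lambda>_. borel) Z I"
    and range: "\<And>i x. i \<in> I \<Longrightarrow> Z i x \<in> {0..1}"
    and mean: "\<And>i. i \<in> I \<Longrightarrow> q \<le> expectation (Z i)"
    and "c \<le> q"
  shows "prob {x \<in> space M. (\<Sum>i\<in>I. Z i x) \<le> real (card I) * c}
           \<le> exp (- 2 * real (card I) * (q - c)\<^sup>2)"
proof (cases "I = {}")
  case False
  define \<mu> where "\<mu> = (\<Sum>i\<in>I. expectation (Z i))"
  define n where "n = real (card I)"
  have n: "n > 0"
    using False \<open>finite I\<close> by (simp add: n_def card_gt_0_iff)
  interpret Hoeffding_ineq M I Z "\<lambda>_. 0" "\<lambda>_. 1" \<mu>
    by unfold_locales (use assms in \<open>auto simp: \<mu>_def\<close>)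
  have \<mu>: "n * q \<le> \<mu>"
    unfolding \<mu>_def n_def using sum_bounded_below[of I q "\<lambda>i. expectation (Z i)"] mean by simp
  \<comment> \<open>Nonnegativity of the smaller deviation lets the comparison pass to the squares below.\<close>
  have gap: "0 \<le> n * (q - c)" "n * (q - c) \<le> \<mu> - n * c"
    using n \<open>c \<le> q\<close> \<mu> by (auto simp: algebra_simps)
  have "prob {x \<in> space M. (\<Sum>i\<in>I. Z i x) \<le> \<mu> - (\<mu> - n * c)} \<le> exp (- 2 * (\<mu> - n * c)\<^sup>2 / n)"
    using Hoeffding_ineq_le[of "\<mu> - n * c"] gap n by (simp add: n_def)
  also have "\<dots> \<le> exp (- 2 * (n * (q - c))\<^sup>2 / n)"
    using power_mono[OF gap(2,1), of 2] n by (simp add: divide_right_mono)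
  also have "- 2 * (n * (q - c))\<^sup>2 / n = - 2 * n * (q - c)\<^sup>2"
    using n by (simp add: power2_eq_square)
  finally show ?thesis by (simp add: n_def)
qed simp

text \<open>The reflection \<open>z \<mapsto> 1 - z\<close> preserves the unit interval and exchanges the two tails.\<close>

lemma Hoeffding_upper_tail_unit_interval:
  fixes Z :: "'b \<Rightarrow> 'a \<Rightarrow> real"
  assumes "finite I" and indep: "indep_vars (\<lambda>_. borel) Z I"
    and range: "\<And>i x. i \<in> I \<Longrightarrow> Z i x \<in> {0..1}"
    and mean: "\<And>i. i \<in> I \<Longrightarrow> expectation (Z i) \<le> q"
    and "q \<le> c"
  shows "prob {x \<in> space M. real (card I) * c \<le> (\<Sum>i\<in>I. Z i x)}
           \<le> exp (- 2 * real (card I) * (c - q)\<^sup>2)"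
proof -
  have rv: "random_variable borel (Z i)" if "i \<in> I" for i
    using indep that unfolding indep_vars_def by blast
  have int: "integrable M (Z i)" if "i \<in> I" for i
    by (rule integrable_const_bound[of _ 1]) (use range[OF that] rv[OF that] in auto)
  have "prob {x \<in> space M. (\<Sum>i\<in>I. 1 - Z i x) \<le> real (card I) * (1 - c)}
          \<le> exp (- 2 * real (card I) * ((1 - q) - (1 - c))\<^sup>2)"
  proof (rule Hoeffding_lower_tail_unit_interval)
    show "indep_vars (\<lambda>_. borel) (\<lambda>i x. 1 - Z i x) I"
      by (rule indep_vars_compose2[OF indep]) simp
    show "1 - q \<le> expectation (\<lambda>x. 1 - Z i x)" if "i \<in> I" for i
      using mean[OF that] int[OF that] by (simp add: prob_space)
  qed (use assms in auto)
  then show ?thesis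
    by (simp add: sum_subtractf algebra_simps)
qed

section \<open>Independence of activities and of window votes\<close>

lemma (in -) of_nat_activity_count:
  "(\<Sum>u<W. of_bool (s i ((r - 1) * W + u) x)) = real (activity_count W s i r x)"
  by (simp add: activity_count_def)

lemma iid_bernoulli_activity_indep:
  assumes "iid_bernoulli_activity M a q"
  shows "indep_vars (\<lambda>_. count_space UNIV) a UNIV"
  using assms unfolding iid_bernoulli_activity_def by blast

lemma iid_bernoulli_activity_measurable:
  assumes "iid_bernoulli_activity M a q"
  shows "a t \<in> measurable M (count_space UNIV)"
  using iid_bernoulli_activity_indep[OF assms] unfolding indep_vars_def by blast

lemma iid_bernoulli_activity_mean:
  assumes act: "iid_bernoulli_activity M a q" and "0 \<le> q" "q \<le> 1"
  shows "expectation (\<lambda>x. of_bool (a t x)) = q"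
proof -
  have "expectation (\<lambda>x. of_bool (a t x) :: real) = (\<integral>b. of_bool b \<partial>distr M (count_space UNIV) (a t))"
    using iid_bernoulli_activity_measurable[OF act] by (subst integral_distr) auto
  also have "distr M (count_space UNIV) (a t) = measure_pmf (bernoulli_pmf q)"
    using act unfolding iid_bernoulli_activity_def by blast
  also have "(\<integral>b. of_bool b \<partial>measure_pmf (bernoulli_pmf q)) = q"
    using assms by simp
  finally show ?thesis .
qed

text \<open>
  Independence passes to a reindexed family by the grouping theorem: the \<open>u\<close>-th group is the single
  time \<open>(r - 1) * W + u\<close>, and these groups are disjoint.
\<close>

lemma indep_vars_window_activity:
  assumes "iid_bernoulli_activity M (s i) q"
  shows "indep_vars (\<lambda>_. borel) (\<lambda>u x. of_bool (s i ((r - 1) * W + u) x) :: real) {..<W}"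
proof -
  let ?t = "\<lambda>u. (r - 1) * W + u"
  have "indep_vars (\<lambda>u. PiM {?t u} (\<lambda>_. count_space UNIV))
      (\<lambda>u x. restrict (\<lambda>t. s i t x) {?t u}) {..<W}"
    by (rule indep_vars_restrict[OF iid_bernoulli_activity_indep[OF assms]])
       (auto simp: disjoint_family_on_def)
  then have "indep_vars (\<lambda>_. borel)
      (\<lambda>u x. of_bool (restrict (\<lambda>t. s i t x) {?t u} (?t u)) :: real) {..<W}"
    by (rule indep_vars_compose2[where Y = "\<lambda>u f. of_bool (f (?t u))"])
       (rule measurable_compose[OF measurable_component_singleton], auto)
  then show ?thesis by simp
qed

text \<open>
  A vote is a measurable function of the activities in its own block of \<open>W\<close> consecutive times, and
  distinct blocks are disjoint. The index \<open>r = 0\<close> has to be left out: truncated subtraction gives it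
  the same block as \<open>r = 1\<close>.
\<close>

lemma indep_vars_window_vote:
  assumes act: "iid_bernoulli_activity M (s i) q"
  shows "indep_vars (\<lambda>_. borel) (window_vote W k s i) {1..R}"
proof -
  define B where "B r = {(r - 1) * W..<(r - 1) * W + W}" for r :: nat
  define vote where "vote r f = (of_bool (real k \<le> (\<Sum>u<W. of_bool (f ((r - 1) * W + u)))) :: real)"
    for r and f :: "nat \<Rightarrow> bool"
  have "disjoint_family_on B {1..R}"
    unfolding disjoint_family_on_def
  proof (intro ballI impI equals0I)
    fix m n t assume "m \<in> {1..R}" "n \<in> {1..R}" "m \<noteq> n" and t: "t \<in> B m \<inter> B n"
    have "t div W = r - 1" if "t \<in> B r" for r
      using that by (intro div_nat_eqI) (auto simp: B_def algebra_simps)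
    with t have "m - 1 = n - 1" by (metis IntD1 IntD2)
    with \<open>m \<in> {1..R}\<close> \<open>n \<in> {1..R}\<close> \<open>m \<noteq> n\<close> show False by auto
  qed
  then have "indep_vars (\<lambda>r. PiM (B r) (\<lambda>_. count_space UNIV))
      (\<lambda>r x. restrict (\<lambda>t. s i t x) (B r)) {1..R}"
    by (intro indep_vars_restrict[OF iid_bernoulli_activity_indep[OF act]]) auto
  moreover have "vote r \<in> measurable (PiM (B r) (\<lambda>_. count_space UNIV)) borel" for r
  proof -
    have "(\<lambda>f. f ((r - 1) * W + u)) \<in> measurable (PiM (B r) (\<lambda>_. count_space UNIV)) (count_space (UNIV :: bool set))"
      if "u < W" for u
      by (rule measurable_component_singleton) (use that in \<open>simp add: B_def\<close>)
    then have [measurable]: "(\<lambda>f. \<Sum>u<W. of_bool (f ((r - 1) * W + u)) :: real)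
        \<in> borel_measurable (PiM (B r) (\<lambda>_. count_space UNIV))"
      by (intro borel_measurable_sum) (auto intro: measurable_compose)
    show ?thesis unfolding vote_def by measurable
  qed
  ultimately have "indep_vars (\<lambda>_. borel) (\<lambda>r x. vote r (restrict (\<lambda>t. s i t x) (B r))) {1..R}"
    by (rule indep_vars_compose2)
  moreover have "vote r (restrict (\<lambda>t. s i t x) (B r)) = window_vote W k s i r x" for r x
  proof -
    have "(\<Sum>u<W. of_bool (restrict (\<lambda>t. s i t x) (B r) ((r - 1) * W + u)))
        = real (activity_count W s i r x)"
      by (simp add: activity_count_def B_def)
    then show ?thesis by (simp add: vote_def window_vote_def)
  qed
  ultimately show ?thesis by simp
qed

section \<open>Means of the window votes\<close>

lemma random_variable_window_vote:
  assumes "iid_bernoulli_activity M (s i) q"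
  shows "random_variable borel (window_vote W k s i r)"
proof -
  note [measurable] = iid_bernoulli_activity_measurable[OF assms]
  have "window_vote W k s i r =
      (\<lambda>x. of_bool (real k \<le> (\<Sum>u<W. of_bool (s i ((r - 1) * W + u) x))))"
    by (simp only: of_nat_activity_count of_nat_le_iff) (simp add: window_vote_def fun_eq_iff)
  then show ?thesis by simp
qed

lemma expectation_window_vote:
  assumes "iid_bernoulli_activity M (s i) q"
  shows "expectation (window_vote W k s i r) = prob {x \<in> space M. k \<le> activity_count W s i r x}"
    and "{x \<in> space M. k \<le> activity_count W s i r x} \<in> events"
proof -
  have "{x \<in> space M. k \<le> activity_count W s i r x} = {x \<in> space M. window_vote W k s i r x = 1}"
    by (auto simp: window_vote_def)
  then show ev: "{x \<in> space M. k \<le> activity_count W s i r x} \<in> events"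
    using random_variable_window_vote[of s i, OF assms, of W k r] by simp
  have "expectation (window_vote W k s i r)
      = expectation (indicator {x \<in> space M. k \<le> activity_count W s i r x})"
    by (rule Bochner_Integration.integral_cong) (auto simp: window_vote_def indicator_def)
  with ev show "expectation (window_vote W k s i r)
      = prob {x \<in> space M. k \<le> activity_count W s i r x}" by simp
qed

text \<open>
  A vote fails when the count is strictly below \<open>k\<close>. This event is enlarged to a count of at most
  \<open>k = W * (k / W)\<close>, the non-strict lower tail that Hoeffding's inequality bounds.
\<close>

lemma expectation_window_vote_ge:
  assumes act: "iid_bernoulli_activity M (s i) q" and "q \<le> 1"
    and "W \<ge> 1" and "real k / real W \<le> \<rho>" and "\<rho> \<le> q"
  shows "1 - exp (- 2 * real W * (\<rho> - real k / real W)\<^sup>2) \<le> expectation (window_vote W k s i r)"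
proof -
  have "0 \<le> real k / real W" by simp
  with assms have "0 \<le> q" by linarith
  have "prob {x \<in> space M. (\<Sum>u<W. of_bool (s i ((r - 1) * W + u) x))
            \<le> real (card {..<W}) * (real k / real W)}
          \<le> exp (- 2 * real (card {..<W}) * (\<rho> - real k / real W)\<^sup>2)"
    by (rule Hoeffding_lower_tail_unit_interval[OF _ indep_vars_window_activity[of s i, OF act]])
       (use assms \<open>0 \<le> q\<close> in \<open>simp_all add: iid_bernoulli_activity_mean[OF act]\<close>)
  then have tail: "prob {x \<in> space M. activity_count W s i r x \<le> k}
      \<le> exp (- 2 * real W * (\<rho> - real k / real W)\<^sup>2)"
    using \<open>W \<ge> 1\<close> unfolding of_nat_activity_count by simp
  \<comment> \<open>Measurability of the enlarged event: its complement is a vote with threshold \<open>Suc k\<close>.\<close>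
  have "{x \<in> space M. Suc k \<le> activity_count W s i r x} \<in> events"
    by (rule expectation_window_vote(2)[of s i, OF act])
  then have "space M - {x \<in> space M. Suc k \<le> activity_count W s i r x} \<in> events"
    by simp
  moreover have "space M - {x \<in> space M. Suc k \<le> activity_count W s i r x}
      = {x \<in> space M. activity_count W s i r x \<le> k}" by auto
  ultimately have ev: "{x \<in> space M. activity_count W s i r x \<le> k} \<in> events" by simp
  have "1 - expectation (window_vote W k s i r)
      = prob (space M - {x \<in> space M. k \<le> activity_count W s i r x})"
    using prob_compl[OF expectation_window_vote(2)[of s i, OF act]] by (simp add: expectation_window_vote(1)[of s i, OF act])
  also have "\<dots> \<le> prob {x \<in> space M. activity_count W s i r x \<le> k}"
    by (rule finite_measure_mono) (use ev in auto)
  finally show ?thesis using tail by linarith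
qed

lemma expectation_window_vote_le:
  assumes act: "iid_bernoulli_activity M (s i) q" and "0 \<le> q"
    and "W \<ge> 1" and "k \<le> W" and "\<rho> \<le> real k / real W" and "q \<le> \<rho>"
  shows "expectation (window_vote W k s i r) \<le> exp (- 2 * real W * (real k / real W - \<rho>)\<^sup>2)"
proof -
  have "real k / real W \<le> 1" using assms by simp
  with assms have "q \<le> 1" by linarith
  have "prob {x \<in> space M. real (card {..<W}) * (real k / real W)
            \<le> (\<Sum>u<W. of_bool (s i ((r - 1) * W + u) x))}
          \<le> exp (- 2 * real (card {..<W}) * (real k / real W - \<rho>)\<^sup>2)"
    by (rule Hoeffding_upper_tail_unit_interval[OF _ indep_vars_window_activity[of s i, OF act]])
       (use assms \<open>q \<le> 1\<close> in \<open>simp_all add: iid_bernoulli_activity_mean[OF act]\<close>)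
  then show ?thesis
    using \<open>W \<ge> 1\<close> unfolding expectation_window_vote(1)[of s i, OF act] of_nat_activity_count
    by simp
qed

section \<open>Misclassification of a single agent\<close>

lemma prob_vote_score_less:
  assumes act: "iid_bernoulli_activity M (s i) q" and "R \<ge> 1"
    and mean: "\<And>r. \<pi> \<le> expectation (window_vote W k s i r)" and "c \<le> \<pi>"
  shows "prob {x \<in> space M. vote_score W k s R i x < c} \<le> exp (- 2 * real R * (\<pi> - c)\<^sup>2)"
proof -
  note [measurable] = random_variable_window_vote[of s i, OF act]
  have "prob {x \<in> space M. vote_score W k s R i x < c}
      \<le> prob {x \<in> space M. (\<Sum>r=1..R. window_vote W k s i r x) \<le> real (card {1..R}) * c}"
    by (rule finite_measure_mono) (use \<open>R \<ge> 1\<close> in \<open>auto simp: vote_score_def field_simps\<close>)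
  also have "\<dots> \<le> exp (- 2 * real (card {1..R}) * (\<pi> - c)\<^sup>2)"
    by (rule Hoeffding_lower_tail_unit_interval[OF _ indep_vars_window_vote[of s i, OF act]])
       (use assms in \<open>auto simp: window_vote_def\<close>)
  finally show ?thesis by simp
qed

lemma prob_vote_score_ge:
  assumes act: "iid_bernoulli_activity M (s i) q" and "R \<ge> 1"
    and mean: "\<And>r. expectation (window_vote W k s i r) \<le> \<pi>" and "\<pi> \<le> c"
  shows "prob {x \<in> space M. c \<le> vote_score W k s R i x} \<le> exp (- 2 * real R * (c - \<pi>)\<^sup>2)"
proof -
  have "{x \<in> space M. c \<le> vote_score W k s R i x}
      = {x \<in> space M. real (card {1..R}) * c \<le> (\<Sum>r=1..R. window_vote W k s i r x)}"
    using \<open>R \<ge> 1\<close> by (auto simp: vote_score_def field_simps)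
  moreover have "prob \<dots> \<le> exp (- 2 * real (card {1..R}) * (c - \<pi>)\<^sup>2)"
    by (rule Hoeffding_upper_tail_unit_interval[OF _ indep_vars_window_vote[of s i, OF act]])
       (use assms in \<open>auto simp: window_vote_def\<close>)
  ultimately show ?thesis by simp
qed

lemma random_variable_vote_score:
  assumes "iid_bernoulli_activity M (s i) q"
  shows "random_variable borel (vote_score W k s R i)"
proof -
  note [measurable] = random_variable_window_vote[of s i, OF assms]
  have "vote_score W k s R i = (\<lambda>x. (1 / real R) * (\<Sum>r=1..R. window_vote W k s i r x))"
    by (simp add: vote_score_def fun_eq_iff)
  then show ?thesis by simp
qed

section \<open>The number of misclassified agents\<close>

lemma random_variable_hamming_error:
  assumes "\<And>i. i \<in> A \<Longrightarrow> iid_bernoulli_activity M (s i) (p i)"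
  shows "random_variable borel (hamming_error A X W k lam s R)"
proof -
  have "(\<lambda>x. \<bar>estimated_label W k lam s R i x - true_label X i\<bar>) \<in> borel_measurable M" if "i \<in> A" for i
  proof -
    note [measurable] = random_variable_vote_score[of s i, OF assms[OF that]]
    show ?thesis unfolding estimated_label_def by measurable
  qed
  then show ?thesis
    unfolding hamming_error_def[abs_def] by (rule borel_measurable_sum)
qed

text \<open>
  Each label error is the indicator of a misclassification: too low a score for an agent in \<open>X\<close>, a
  score of at least \<open>lam\<close> for the others. The mean then splits by linearity.
\<close>

lemma expectation_hamming_error:
  assumes "finite A" and "X \<subseteq> A"
    and act: "\<And>i. i \<in> A \<Longrightarrow> iid_bernoulli_activity M (s i) (p i)"
  shows "expectation (hamming_error A X W k lam s R)
      = (\<Sum>i\<in>X. prob {x \<in> space M. vote_score W k s R i x < lam})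
        + (\<Sum>i\<in>A - X. prob {x \<in> space M. lam \<le> vote_score W k s R i x})"
proof -
  define E where "E i = {x \<in> space M. vote_score W k s R i x < lam \<longleftrightarrow> i \<in> X}" for i
  have E: "E i \<in> events" if "i \<in> A" for i
  proof -
    note [measurable] = random_variable_vote_score[of s i, OF act[OF that]]
    show ?thesis unfolding E_def by measurable
  qed
  have "expectation (hamming_error A X W k lam s R) = expectation (\<lambda>x. \<Sum>i\<in>A. indicator (E i) x)"
    by (rule Bochner_Integration.integral_cong)
       (auto simp: hamming_error_def estimated_label_def true_label_def E_def indicator_def
             intro!: sum.cong)
  also have "\<dots> = (\<Sum>i\<in>A. prob (E i))"
    using E by (subst Bochner_Integration.integral_sum) (auto simp: less_top[symmetric])
  also have "\<dots> = (\<Sum>i\<in>A - X. prob (E i)) + (\<Sum>i\<in>X. prob (E i))"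
    using assms by (intro sum.subset_diff) auto
  finally show ?thesis
    by (simp add: E_def not_less add.commute)
qed

text \<open>
  Markov's inequality at level \<open>1\<close>: a nonzero error is at least \<open>1\<close>, since every summand is \<open>0\<close> or
  \<open>1\<close>.
\<close>

lemma prob_hamming_error_eq_0:
  assumes "finite A"
    and act: "\<And>i. i \<in> A \<Longrightarrow> iid_bernoulli_activity M (s i) (p i)"
  shows "1 - expectation (hamming_error A X W k lam s R)
      \<le> prob {x \<in> space M. hamming_error A X W k lam s R x = 0}"
proof -
  let ?D = "hamming_error A X W k lam s R"
  note [measurable] = random_variable_hamming_error[of A s p X W k lam R, OF act]
  have summand: "\<bar>estimated_label W k lam s R i x - true_label X i\<bar> \<in> {0, 1}" for i x
    by (auto simp: estimated_label_def true_label_def)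
  have ge1: "1 \<le> ?D x" if nz: "?D x \<noteq> 0" for x
  proof -
    from nz obtain i where "i \<in> A" and i: "\<bar>estimated_label W k lam s R i x - true_label X i\<bar> \<noteq> 0"
      unfolding hamming_error_def by (rule sum.not_neutral_contains_not_neutral)
    then have "\<bar>estimated_label W k lam s R i x - true_label X i\<bar> = 1"
      using summand[of i x] by blast
    moreover have "\<bar>estimated_label W k lam s R i x - true_label X i\<bar> \<le> ?D x"
      unfolding hamming_error_def
      by (rule member_le_sum[where f = "\<lambda>i. \<bar>estimated_label W k lam s R i x - true_label X i\<bar>"])
         (use \<open>i \<in> A\<close> \<open>finite A\<close> in auto)
    ultimately show ?thesis by simp
  qed
  have nonneg: "0 \<le> ?D x" for x
    by (simp add: hamming_error_def sum_nonneg)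
  have int: "integrable M ?D"
  proof (rule integrable_const_bound[of _ "real (card A)"])
    have "norm (?D x) \<le> (\<Sum>i\<in>A. 1)" for x
      unfolding hamming_error_def real_norm_def
      by (rule order_trans[OF sum_abs], rule sum_mono)
         (auto simp: estimated_label_def true_label_def)
    then show "AE x in M. norm (?D x) \<le> real (card A)" by simp
  qed measurable
  have "1 - prob {x \<in> space M. ?D x = 0} = prob (space M - {x \<in> space M. ?D x = 0})"
    by (rule prob_compl[symmetric]) measurable
  also have "space M - {x \<in> space M. ?D x = 0} = {x \<in> space M. 1 \<le> ?D x}"
    using ge1 by fastforce
  also have "prob \<dots> \<le> expectation ?D / 1"
    by (rule integral_Markov_inequality_measure[where A = "space M"])
       (use int in \<open>auto intro!: AE_I2 simp: nonneg\<close>)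
  finally show ?thesis by simp
qed

end

section \<open>Identification of the persistent agents\<close>

theorem theorem1:
  fixes M :: "'w measure"
    and N W k R :: nat
    and A X Y :: "nat set"
    and s :: "nat \<Rightarrow> nat \<Rightarrow> 'w \<Rightarrow> bool"
    and p :: "nat \<Rightarrow> real"
    and \<theta> \<delta> \<rho>P \<rho>N \<pi>P \<pi>N lam \<Delta>P \<Delta>N \<Delta> :: real
    and D :: "'w \<Rightarrow> real"
  assumes "prob_space M"
    and "N \<ge> 1" and "A = {1..N}" and "X \<subseteq> A" and "Y = A - X"
    and "\<And>i. i \<in> A \<Longrightarrow> 0 < p i \<and> p i \<le> 1"
    and "\<And>i. i \<in> A \<Longrightarrow> iid_bernoulli_activity M (s i) (p i)"
    and "W \<ge> 1" and "1 \<le> k" and "k \<le> W"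
    and "\<theta> = real k / real W"
    and "0 < \<delta>" and "\<delta> < 1 / 2"
    and "\<rho>P = \<theta> + sqrt (1 / (2 * real W) * ln (1 / \<delta>))"
    and "\<rho>N = \<theta> - sqrt (1 / (2 * real W) * ln (1 / \<delta>))"
    and "0 \<le> \<rho>N" and "\<rho>N < \<theta>" and "\<theta> < \<rho>P" and "\<rho>P \<le> 1"
    and "\<And>i. i \<in> X \<Longrightarrow> p i \<ge> \<rho>P"
    and "\<And>j. j \<in> Y \<Longrightarrow> p j \<le> \<rho>N"
    and "\<pi>P = 1 - exp (- 2 * real W * (\<rho>P - \<theta>)\<^sup>2)"
    and "\<pi>N = exp (- 2 * real W * (\<theta> - \<rho>N)\<^sup>2)"
    and "0 < lam" and "lam < 1" and "\<pi>N < lam" and "lam < \<pi>P"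
    and "\<Delta>P = \<pi>P - lam" and "\<Delta>N = lam - \<pi>N" and "\<Delta> = min \<Delta>P \<Delta>N"
    and "R \<ge> 1"
    and "D = hamming_error A X W k lam s R"
  shows "prob_space.expectation M D
           \<le> real (card X) * exp (- 2 * real R * \<Delta>P\<^sup>2) + real (card Y) * exp (- 2 * real R * \<Delta>N\<^sup>2)
       \<and> real (card X) * exp (- 2 * real R * \<Delta>P\<^sup>2) + real (card Y) * exp (- 2 * real R * \<Delta>N\<^sup>2)
           \<le> real (card A) * exp (- 2 * real R * \<Delta>\<^sup>2)
       \<and> prob_space.prob M {\<omega> \<in> space M. D \<omega> = 0} \<ge> 1 - real (card A) * exp (- 2 * real R * \<Delta>\<^sup>2)
       \<and> (\<forall>\<rho>. 0 < \<rho> \<and> \<rho> < 1 \<and> real R \<ge> 1 / (2 * \<Delta>\<^sup>2) * ln (real (card A) / \<rho>) \<longrightarrow>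
             prob_space.prob M {\<omega> \<in> space M. D \<omega> = 0} \<ge> 1 - \<rho>)"
proof -
  interpret prob_space M by fact
  note act = assms(7)
  have fin: "finite A" and card_A: "card A = N" using assms(3) by auto
  have card_split: "real (card X) + real (card Y) = real (card A)"
    using card_Diff_subset[of X A] card_mono[OF fin \<open>X \<subseteq> A\<close>] finite_subset[OF \<open>X \<subseteq> A\<close> fin]
      \<open>X \<subseteq> A\<close> \<open>Y = A - X\<close> by simp
  have \<Delta>: "0 < \<Delta>" "\<Delta> \<le> \<Delta>P" "\<Delta> \<le> \<Delta>N"
    using assms(26-30) by auto

  have X_err: "prob {x \<in> space M. vote_score W k s R i x < lam} \<le> exp (- 2 * real R * \<Delta>P\<^sup>2)"
    if "i \<in> X" for i
    unfolding \<open>\<Delta>P = \<pi>P - lam\<close>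
  proof (rule prob_vote_score_less)
    have "i \<in> A" using that \<open>X \<subseteq> A\<close> by blast
    then show act_i: "iid_bernoulli_activity M (s i) (p i)" by (rule act)
    show "\<pi>P \<le> expectation (window_vote W k s i r)" for r
      using expectation_window_vote_ge[of s i "p i" W k \<rho>P r, OF act_i] assms(6)[OF \<open>i \<in> A\<close>]
        assms(8,11,18,22) assms(20)[OF that] by simp
  qed (use assms in auto)
  have Y_err: "prob {x \<in> space M. lam \<le> vote_score W k s R j x} \<le> exp (- 2 * real R * \<Delta>N\<^sup>2)"
    if "j \<in> Y" for j
    unfolding \<open>\<Delta>N = lam - \<pi>N\<close>
  proof (rule prob_vote_score_ge)
    have "j \<in> A" using that \<open>Y = A - X\<close> by blast
    then show act_j: "iid_bernoulli_activity M (s j) (p j)" by (rule act)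
    show "expectation (window_vote W k s j r) \<le> \<pi>N" for r
      using expectation_window_vote_le[of s j "p j" W k \<rho>N r, OF act_j] assms(6)[OF \<open>j \<in> A\<close>]
        assms(8,10,11,17,23) assms(21)[OF that] by simp
  qed (use assms in auto)

  have "expectation D = (\<Sum>i\<in>X. prob {x \<in> space M. vote_score W k s R i x < lam})
      + (\<Sum>j\<in>Y. prob {x \<in> space M. lam \<le> vote_score W k s R j x})"
    unfolding \<open>D = _\<close> \<open>Y = A - X\<close>
    by (rule expectation_hamming_error) (use fin \<open>X \<subseteq> A\<close> act in auto)
  also have "\<dots> \<le> real (card X) * exp (- 2 * real R * \<Delta>P\<^sup>2)
      + real (card Y) * exp (- 2 * real R * \<Delta>N\<^sup>2)"
    by (intro add_mono sum_bounded_above X_err Y_err)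
  finally have mean: "expectation D \<le> \<dots>" .

  have "exp (- 2 * real R * \<Delta>'\<^sup>2) \<le> exp (- 2 * real R * \<Delta>\<^sup>2)" if "\<Delta> \<le> \<Delta>'" for \<Delta>'
    using power_mono[OF that, of 2] \<Delta>(1) by (simp add: mult_left_mono)
  then have worst: "real (card X) * exp (- 2 * real R * \<Delta>P\<^sup>2) + real (card Y) * exp (- 2 * real R * \<Delta>N\<^sup>2)
      \<le> real (card A) * exp (- 2 * real R * \<Delta>\<^sup>2)"
    unfolding card_split[symmetric] distrib_right
    using \<Delta> by (intro add_mono mult_left_mono) auto

  have exact: "prob {\<omega> \<in> space M. D \<omega> = 0} \<ge> 1 - real (card A) * exp (- 2 * real R * \<Delta>\<^sup>2)"
  proof -
    have "1 - expectation D \<le> prob {\<omega> \<in> space M. D \<omega> = 0}"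
      unfolding \<open>D = _\<close> by (rule prob_hamming_error_eq_0) (use fin act in auto)
    with mean worst show ?thesis by linarith
  qed

  have "real (card A) * exp (- 2 * real R * \<Delta>\<^sup>2) \<le> \<rho>"
    if "0 < \<rho>" and R: "real R \<ge> 1 / (2 * \<Delta>\<^sup>2) * ln (real (card A) / \<rho>)" for \<rho>
  proof -
    have "card A > 0" using card_A \<open>N \<ge> 1\<close> by simp
    have "ln (real (card A) / \<rho>) \<le> 2 * real R * \<Delta>\<^sup>2"
      using R \<Delta>(1) by (simp add: field_simps)
    then have "exp (ln (real (card A) / \<rho>)) \<le> exp (2 * real R * \<Delta>\<^sup>2)"
      by simp
    then have "real (card A) / \<rho> \<le> exp (2 * real R * \<Delta>\<^sup>2)"
      using \<open>card A > 0\<close> \<open>0 < \<rho>\<close> by simp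
    then show ?thesis
      using \<open>0 < \<rho>\<close> by (simp add: exp_minus field_simps)
  qed
  with exact have "\<forall>\<rho>. 0 < \<rho> \<and> \<rho> < 1 \<and> real R \<ge> 1 / (2 * \<Delta>\<^sup>2) * ln (real (card A) / \<rho>) \<longrightarrow>
             prob {\<omega> \<in> space M. D \<omega> = 0} \<ge> 1 - \<rho>"
    by (smt (verit))
  with mean worst exact show ?thesis by blast
qed

end
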